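(* Let $\Delta$ be a connected, pure $(d-1)$-dimensional simplicial complex with $d\ge 4$ that is semi-Eulerian, and suppose $(\Delta,\phi)$ is a balanced complex of type $\mathbf{a}=(a_1,\dots,a_m)$. Then for every $\mathbf{b}\le \mathbf{a}$, $$h_{\mathbf{a}-\mathbf{b}}-h_{\mathbf{b}}=(-1)^{|\mathbf{b}|}\,\bigl[\chi(\Delta)-\chi(S^{d-1})\bigr]\prod_{j=1}^m\binom{a_j}{b_j}.$$
   Context: $\chi$ denotes the (unreduced) Euler characteristic, so $\chi(S^{d-1})=1+(-1)^{d-1}$. The link of a face $\rho$ is $\operatorname{lk}\rho=\{\tau\in\Delta:\tau\cap\rho=\emptyset,\ \tau\cup\rho\in\Delta\}$. $\Delta$ is semi-Eulerian if for every nonempty face $\rho$, $\chi(\operatorname{lk}\rho)=\chi(S^{d-|\rho|-1})$. Let $V$ be the vertex set, $\mathbf{a}=(a_1,\dots,a_m)$ positive integers with $|\mathbf{a}|=a_1+\dots+a_m=d$, and $\phi:V\to\{1,\dots,m\}$ surjective; $(\Delta,\phi)$ is balanced of type $\mathbf{a}$ if every facet $\sigma$ satisfies $|\sigma\cap\phi^{-1}(j)|=a_j$ for all $j$. For integer vectors $\mathbf{b}=(b_1,\dots,b_m)$ write $\mathbf{b}\le\mathbf{a}$ if $0\le b_j\le a_j$ for all $j$; $|\mathbf{b}|=\sum b_j$ and $\mathbf{a}-\mathbf{b}=(a_1-b_1,\dots,a_m-b_m)$. For $\mathbf{b}\le\mathbf{a}$, $f_{\mathbf{b}}$ is the number of faces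 $\rho$ (including the empty face) with $|\rho\cap\phi^{-1}(j)|=b_j$ for all $j$, and the fine $h$-vector is $h_{\mathbf{b}}=\sum_{\mathbf{c}\le\mathbf{b}} f_{\mathbf{c}}\prod_{i=1}^m(-1)^{b_i-c_i}\binom{a_i-c_i}{b_i-c_i}$. *)

theory Defs
  imports Main "HOL-Library.FuncSet"
begin

text \<open>Complexes are finite and abstract; the empty set is a face.\<close>

definition abstract_complex :: "'a set set \<Rightarrow> bool" where
  "abstract_complex \<Delta> \<longleftrightarrow>
     finite \<Delta> \<and> {} \<in> \<Delta> \<and> (\<forall>\<sigma>\<in>\<Delta>. finite \<sigma> \<and> (\<forall>\<tau>. \<tau> \<subseteq> \<sigma> \<longrightarrow> \<tau> \<in> \<Delta>))"

definition vertex_set :: "'a set set \<Rightarrow> 'a set" where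
  "vertex_set \<Delta> = \<Union>\<Delta>"

definition is_facet :: "'a set set \<Rightarrow> 'a set \<Rightarrow> bool" where
  "is_facet \<Delta> \<sigma> \<longleftrightarrow> \<sigma> \<in> \<Delta> \<and> (\<forall>\<tau>\<in>\<Delta>. \<sigma> \<subseteq> \<tau> \<longrightarrow> \<tau> = \<sigma>)"

text \<open>Here \<open>d\<close> is the common size of the facets, so the dimension is \<open>d - 1\<close>.\<close>

definition pure_complex :: "nat \<Rightarrow> 'a set set \<Rightarrow> bool" where
  "pure_complex d \<Delta> \<longleftrightarrow> (\<forall>\<sigma>. is_facet \<Delta> \<sigma> \<longrightarrow> card \<sigma> = d)"

text \<open>Any two vertices are joined by a path of edges.\<close>

definition connected_complex :: "'a set set \<Rightarrow> bool" where
  "connected_complex \<Delta> \<longleftrightarrow>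
     (\<forall>u\<in>vertex_set \<Delta>. \<forall>v\<in>vertex_set \<Delta>. (u, v) \<in> {(x, y). {x, y} \<in> \<Delta>}\<^sup>*)"

definition link :: "'a set set \<Rightarrow> 'a set \<Rightarrow> 'a set set" where
  "link \<Delta> \<rho> = {\<tau>\<in>\<Delta>. \<tau> \<inter> \<rho> = {} \<and> \<tau> \<union> \<rho> \<in> \<Delta>}"

text \<open>Unreduced: the empty face does not contribute, so the complex \<open>{{}}\<close> has value 0.\<close>

definition euler_char :: "'a set set \<Rightarrow> int" where
  "euler_char \<Delta> = (\<Sum>\<sigma>\<in>\<Delta> - {{}}. (- 1) ^ (card \<sigma> - 1))"

text \<open>
  The value \<open>1 + (-1)^n\<close> for the sphere of dimension \<open>n \<ge> -1\<close>. The dimension is an integer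
  because the link of a facet is compared with the empty sphere of dimension \<open>-1\<close>.
\<close>

definition sphere_euler_char :: "int \<Rightarrow> int" where
  "sphere_euler_char n = (if even n then 2 else 0)"

lemma sphere_euler_char_of_nat: "sphere_euler_char (int n) = 1 + (- 1) ^ n"
  by (simp add: sphere_euler_char_def)

lemma sphere_euler_char_minus_one: "sphere_euler_char (- 1) = 0"
  by (simp add: sphere_euler_char_def)

definition semi_eulerian :: "nat \<Rightarrow> 'a set set \<Rightarrow> bool" where
  "semi_eulerian d \<Delta> \<longleftrightarrow>
     (\<forall>\<rho>\<in>\<Delta>. \<rho> \<noteq> {} \<longrightarrow>
        euler_char (link \<Delta> \<rho>) = sphere_euler_char (int d - int (card \<rho>) - 1))"

text \<open>
  Integer vectors indexed by \<open>1, \<dots>, m\<close> with nonnegative entries are functions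
  \<open>nat \<Rightarrow> nat\<close>; only their values on \<open>{1..m}\<close> matter.
\<close>

definition balanced_of_type ::
  "nat \<Rightarrow> 'a set set \<Rightarrow> ('a \<Rightarrow> nat) \<Rightarrow> nat \<Rightarrow> (nat \<Rightarrow> nat) \<Rightarrow> bool" where
  "balanced_of_type d \<Delta> \<phi> m a \<longleftrightarrow>
     (\<forall>j\<in>{1..m}. a j > 0) \<and> (\<Sum>j=1..m. a j) = d \<and>
     \<phi> ` vertex_set \<Delta> = {1..m} \<and>
     (\<forall>\<sigma>. is_facet \<Delta> \<sigma> \<longrightarrow> (\<forall>j\<in>{1..m}. card (\<sigma> \<inter> \<phi> -` {j}) = a j))"

definition fine_f :: "'a set set \<Rightarrow> ('a \<Rightarrow> nat) \<Rightarrow> nat \<Rightarrow> (nat \<Rightarrow> nat) \<Rightarrow> nat" where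
  "fine_f \<Delta> \<phi> m b = card {\<rho>\<in>\<Delta>. \<forall>j\<in>{1..m}. card (\<rho> \<inter> \<phi> -` {j}) = b j}"

text \<open>
  The vectors \<open>c \<le> b\<close> are taken extensional, so that each occurs once in the sum. The natural
  number subtractions do not truncate when \<open>b \<le> a\<close>.
\<close>

definition fine_h ::
  "'a set set \<Rightarrow> ('a \<Rightarrow> nat) \<Rightarrow> nat \<Rightarrow> (nat \<Rightarrow> nat) \<Rightarrow> (nat \<Rightarrow> nat) \<Rightarrow> int" where
  "fine_h \<Delta> \<phi> m a b =
     (\<Sum>c \<in> (\<Pi>\<^sub>E j\<in>{1..m}. {0..b j}).
        int (fine_f \<Delta> \<phi> m c) *
        (\<Prod>i=1..m. (- 1) ^ (b i - c i) * int ((a i - c i) choose (b i - c i))))"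

end

theory Submission
  imports Defs
begin

text \<open>
  Grouping faces by colour counts turns \<open>h\<^sub>b\<close> into \<open>\<Sum>\<^sub>\<rho> \<Prod>\<^sub>i (-1)\<^bsup>b\<^sub>i+n\<^sub>i(\<rho>)\<^esup> (a\<^sub>i-n\<^sub>i(\<rho>) choose a\<^sub>i-b\<^sub>i)\<close>.
  The semi-Eulerian condition says that \<open>\<Sum>\<^bsub>\<sigma>\<supseteq>\<rho>\<^esub> (-1)\<^bsup>|\<sigma>|\<^esup> = (-1)\<^sup>d\<close> for every nonempty face \<open>\<rho>\<close>, while
  for \<open>\<rho> = {}\<close> there is the defect \<open>\<chi>(\<Delta>) - \<chi>(S\<^bsup>d-1\<^esup>)\<close>. Expanding \<open>1\<close> in this way in the sum for
  \<open>h\<^bsub>a-b\<^esub>\<close> and exchanging the two sums, the inner sum over \<open>\<rho> \<subseteq> \<sigma>\<close> factors over the colours and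
  is evaluated by inclusion-exclusion, which gives \<open>h\<^sub>b\<close>; the defect at \<open>{}\<close> gives the right-hand side.
\<close>

section \<open>Alternating subset sums and their factorisation over the colours\<close>

definition colour_count :: "('a \<Rightarrow> nat) \<Rightarrow> 'a set \<Rightarrow> nat \<Rightarrow> nat" where
  "colour_count \<phi> \<rho> j = card (\<rho> \<inter> \<phi> -` {j})"

text \<open>Place \<open>S\<close> inside an \<open>a\<close>-element set. The binomial on the left
  counts the \<open>b\<close>-subsets disjoint from \<open>\<rho>\<close>, so inclusion-exclusion
  leaves the \<open>b\<close>-subsets containing \<open>S\<close>; their complements are the
  (a-b)-subsets avoiding \<open>S\<close>. The induction carries this out with Pascal's
  rule.\<close>

lemma alternating_sum_Pow_choose:
  assumes "finite S" "card S \<le> a" "b \<le> a"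
  shows "(\<Sum>\<rho>\<in>Pow S. (- 1) ^ card \<rho> * int ((a - card \<rho>) choose b)) =
    int ((a - card S) choose (a - b))"
  using assms
proof (induction S arbitrary: a rule: finite_induct)
  case empty
  then show ?case using binomial_symmetric[of b a] by simp
next
  case (insert x S)
  have disj: "Pow S \<inter> insert x ` Pow S = {}" and inj: "inj_on (insert x) (Pow S)"
    using insert.hyps by (auto simp: inj_on_def)
  have card_S: "card S < a" using insert by simp
  have card_insert: "card (insert x \<rho>) = Suc (card \<rho>)" if "\<rho> \<in> Pow S" for \<rho>
    using that insert.hyps by (auto intro!: card_insert_disjoint dest: finite_subset)
  have "(\<Sum>\<rho>\<in>insert x ` Pow S. (- 1) ^ card \<rho> * int ((a - card \<rho>) choose b)) =
    - (\<Sum>\<rho>\<in>Pow S. (- 1) ^ card \<rho> * int ((a - 1 - card \<rho>) choose b))"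
    by (simp add: sum.reindex[OF inj] card_insert sum_negf)
  \<comment> \<open>The induction hypothesis at \<open>a - 1\<close> requires
    \<open>b \<le> a - 1\<close>. For \<open>b = a\<close> every binomial in the sum has upper index
    below \<open>b\<close> and vanishes.\<close>
  also have "\<dots> = - (if b = a then 0 else int ((a - 1 - card S) choose (a - 1 - b)))"
  proof (cases "b = a")
    case True
    then show ?thesis using card_S by (simp add: binomial_eq_0)
  next
    case False
    then show ?thesis using insert.IH[of "a - 1"] insert.prems card_S by simp
  qed
  finally have "(\<Sum>\<rho>\<in>Pow (insert x S). (- 1) ^ card \<rho> * int ((a - card \<rho>) choose b)) =
    int ((a - card S) choose (a - b))
      - (if b = a then 0 else int ((a - 1 - card S) choose (a - 1 - b)))"
    using insert.IH[of a] insert.prems insert.hyps disj card_S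
    by (simp add: Pow_insert sum.union_disjoint)
  also have "\<dots> = int ((a - card (insert x S)) choose (a - b))"
  proof (cases "b = a")
    case False
    \<comment> \<open>These names expose the successors, so that Pascal's rule reads C(p+1,q+1) -
      C(p,q) = C(p,q+1).\<close>
    define p q where "p = a - 1 - card S" and "q = a - 1 - b"
    have "a - card S = Suc p" "a - b = Suc q" "a - card (insert x S) = p"
      using card_S False insert.prems insert.hyps by (auto simp: p_def q_def)
    moreover have "a - 1 - card S = p" "a - 1 - b = q" by (simp_all add: p_def q_def)
    ultimately show ?thesis using False by (simp only: binomial_Suc_Suc) simp
  qed simp
  finally show ?case .
qed

lemma card_eq_sum_colour_count:
  assumes "finite \<sigma>" "finite I" "\<phi> ` \<sigma> \<subseteq> I"
  shows "card \<sigma> = (\<Sum>i\<in>I. colour_count \<phi> \<sigma> i)"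
  unfolding colour_count_def
  using assms by (subst card_UN_disjoint[symmetric]) (auto intro!: arg_cong[where f = card])

text \<open>Choosing a subset of \<open>\<sigma>\<close> amounts to choosing independently a subset
  of each colour class; distributivity then turns the sum of products into a product of
  sums.\<close>

lemma sum_Pow_prod_colour_count:
  fixes g :: "nat \<Rightarrow> nat \<Rightarrow> 'b::comm_semiring_1"
  assumes "finite \<sigma>" "finite I" "\<phi> ` \<sigma> \<subseteq> I"
  shows "(\<Sum>\<rho>\<in>Pow \<sigma>. \<Prod>i\<in>I. g i (colour_count \<phi> \<rho> i)) =
    (\<Prod>i\<in>I. \<Sum>\<tau>\<in>Pow (\<sigma> \<inter> \<phi> -` {i}). g i (card \<tau>))"
proof -
  have "(\<Sum>\<rho>\<in>Pow \<sigma>. \<Prod>i\<in>I. g i (colour_count \<phi> \<rho> i)) =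
    (\<Sum>t\<in>(\<Pi>\<^sub>E i\<in>I. Pow (\<sigma> \<inter> \<phi> -` {i})). \<Prod>i\<in>I. g i (card (t i)))"
  proof (rule sum.reindex_bij_witness[where i = "\<lambda>t. \<Union>i\<in>I. t i"
        and j = "\<lambda>\<rho>. \<lambda>i\<in>I. \<rho> \<inter> \<phi> -` {i}"])
    fix t assume t: "t \<in> (\<Pi>\<^sub>E i\<in>I. Pow (\<sigma> \<inter> \<phi> -` {i}))"
    show "(\<lambda>i\<in>I. (\<Union>i\<in>I. t i) \<inter> \<phi> -` {i}) = t"
    proof
      fix i show "(\<lambda>i\<in>I. (\<Union>i\<in>I. t i) \<inter> \<phi> -` {i}) i = t i"
        using t by (cases "i \<in> I") (fastforce simp: PiE_iff extensional_def)+
    qed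
    show "(\<Union>i\<in>I. t i) \<in> Pow \<sigma>" using t by (fastforce simp: PiE_iff)
  qed (use assms in \<open>auto simp: colour_count_def\<close>)
  also have "\<dots> = (\<Prod>i\<in>I. \<Sum>\<tau>\<in>Pow (\<sigma> \<inter> \<phi> -` {i}). g i (card \<tau>))"
    using assms by (subst prod_sum_PiE) auto
  finally show ?thesis .
qed

section \<open>The fine h-vector as a sum over faces\<close>

text \<open>Faces are grouped by colour vector. The lower index \<open>a i - b i\<close>, equivalent
  by symmetry for vectors below \<open>b\<close>, also makes the weight vanish on all other faces,
  whereas a truncated \<open>b i - c i\<close> would not; hence the sum may run over all of
  \<open>\<Delta>\<close>.\<close>

lemma fine_h_eq_sum_faces:
  assumes fin: "finite \<Delta>"
    and le: "\<And>\<rho> j. \<rho> \<in> \<Delta> \<Longrightarrow> j \<in> {1..m} \<Longrightarrow> colour_count \<phi> \<rho> j \<le> a j"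
    and b: "\<And>j. j \<in> {1..m} \<Longrightarrow> b j \<le> a j"
  shows "fine_h \<Delta> \<phi> m a b = (\<Sum>\<rho>\<in>\<Delta>. \<Prod>i=1..m.
    (- 1) ^ (b i + colour_count \<phi> \<rho> i) * int ((a i - colour_count \<phi> \<rho> i) choose (a i - b i)))"
proof -
  let ?P = "\<Pi>\<^sub>E j\<in>{1..m}. {0..b j}"
  let ?n = "\<lambda>\<rho>. restrict (colour_count \<phi> \<rho>) {1..m}"
  define W where "W c = (\<Prod>i=1..m. (- 1) ^ (b i + c i) * int ((a i - c i) choose (a i - b i)))"
    for c
  have W_eq: "(\<Prod>i=1..m. (- 1) ^ (b i - c i) * int ((a i - c i) choose (b i - c i))) = W c"
    if c: "c \<in> ?P" for c
    unfolding W_def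
  proof (rule prod.cong[OF refl])
    fix i assume i: "i \<in> {1..m}"
    then have ci: "c i \<le> b i" and bi: "b i \<le> a i" using c b by (auto simp: PiE_iff)
    have "(a i - c i) choose (b i - c i) = (a i - c i) choose (a i - b i)"
      using ci bi by (subst binomial_symmetric) auto
    moreover have "(- 1 :: int) ^ (b i - c i) = (- 1) ^ (b i + c i)"
      using ci by (simp add: minus_one_power_iff)
    ultimately show "(- 1) ^ (b i - c i) * int ((a i - c i) choose (b i - c i)) =
      (- 1) ^ (b i + c i) * int ((a i - c i) choose (a i - b i))" by simp
  qed
  have f_eq: "int (fine_f \<Delta> \<phi> m c) * W c = (\<Sum>\<rho>\<in>{\<rho>\<in>\<Delta>. ?n \<rho> = c}. W (?n \<rho>))"
    if c: "c \<in> ?P" for c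
  proof -
    have "{\<rho>\<in>\<Delta>. \<forall>j\<in>{1..m}. card (\<rho> \<inter> \<phi> -` {j}) = c j} = {\<rho>\<in>\<Delta>. ?n \<rho> = c}"
      using c by (auto simp: colour_count_def PiE_iff restrict_def extensional_def fun_eq_iff)
    then show ?thesis by (simp add: fine_f_def)
  qed
  have "fine_h \<Delta> \<phi> m a b = (\<Sum>c\<in>?P. \<Sum>\<rho>\<in>{\<rho>\<in>\<Delta>. ?n \<rho> = c}. W (?n \<rho>))"
    unfolding fine_h_def using W_eq f_eq by (intro sum.cong) auto
  \<comment> \<open>Grouping needs an index set that is mapped into \<open>?P\<close>, so faces with
    other colour vectors are first left out.\<close>
  also have "\<dots> = (\<Sum>c\<in>?P. \<Sum>\<rho>\<in>{\<rho>\<in>{\<rho>\<in>\<Delta>. ?n \<rho> \<in> ?P}. ?n \<rho> = c}. W (?n \<rho>))"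
    by (intro sum.cong) (auto simp: Pi_iff)
  also have "\<dots> = (\<Sum>\<rho>\<in>{\<rho>\<in>\<Delta>. ?n \<rho> \<in> ?P}. W (?n \<rho>))"
    using fin by (intro sum.group) (auto intro: finite_PiE)
  \<comment> \<open>A face left out has more than \<open>b i\<close> vertices of some colour
    \<open>i\<close>, and the binomial factor for that colour is zero.\<close>
  also have "\<dots> = (\<Sum>\<rho>\<in>\<Delta>. W (?n \<rho>))"
  proof (rule sum.mono_neutral_left[OF fin])
    show "\<forall>\<rho>\<in>\<Delta> - {\<rho>\<in>\<Delta>. ?n \<rho> \<in> ?P}. W (?n \<rho>) = 0"
    proof
      fix \<rho> assume \<rho>: "\<rho> \<in> \<Delta> - {\<rho>\<in>\<Delta>. ?n \<rho> \<in> ?P}"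
      then obtain i where i: "i \<in> {1..m}" "b i < colour_count \<phi> \<rho> i"
        by (auto simp: PiE_iff not_le)
      then have "a i - colour_count \<phi> \<rho> i < a i - b i"
        using le[of \<rho> i] \<rho> by auto
      then show "W (?n \<rho>) = 0"
        unfolding W_def using i by (intro prod_zero) (auto intro!: bexI[of _ i] simp: binomial_eq_0)
    qed
  qed auto
  also have "\<dots> = (\<Sum>\<rho>\<in>\<Delta>. W (colour_count \<phi> \<rho>))"
    by (simp add: W_def)
  finally show ?thesis unfolding W_def .
qed

section \<open>Bounding colour counts by the type\<close>

lemma face_in_facet:
  assumes "finite \<Delta>" "\<sigma> \<in> \<Delta>"
  obtains \<tau> where "is_facet \<Delta> \<tau>" "\<sigma> \<subseteq> \<tau>"
  using finite_has_maximal2[OF assms] unfolding is_facet_def by metis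

lemma colour_count_le_type:
  assumes "abstract_complex \<Delta>" "balanced_of_type d \<Delta> \<phi> m a" "\<sigma> \<in> \<Delta>" "j \<in> {1..m}"
  shows "colour_count \<phi> \<sigma> j \<le> a j"
proof -
  obtain \<tau> where \<tau>: "is_facet \<Delta> \<tau>" "\<sigma> \<subseteq> \<tau>"
    using face_in_facet assms by (metis abstract_complex_def)
  then have "finite \<tau>" "card (\<tau> \<inter> \<phi> -` {j}) = a j"
    using assms by (auto simp: abstract_complex_def balanced_of_type_def is_facet_def)
  then show ?thesis
    unfolding colour_count_def using \<tau> by (metis Int_mono card_mono finite_Int subset_refl)
qed

section \<open>Euler characteristics of links and sums over cofaces\<close>

text \<open>This is the negative of the reduced Euler characteristic: the empty face contributes 1,
  and passing from dimension to cardinality flips every other sign.\<close>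

lemma sum_alternating_faces:
  assumes "finite \<Delta>" "{} \<in> \<Delta>" "\<And>\<sigma>. \<sigma> \<in> \<Delta> \<Longrightarrow> finite \<sigma>"
  shows "(\<Sum>\<sigma>\<in>\<Delta>. (- 1) ^ card \<sigma>) = 1 - euler_char \<Delta>"
proof -
  have "(\<Sum>\<sigma>\<in>\<Delta> - {{}}. (- 1) ^ card \<sigma>) = (\<Sum>\<sigma>\<in>\<Delta> - {{}}. - ((- 1) ^ (card \<sigma> - 1)) :: int)"
  proof (rule sum.cong[OF refl])
    fix \<sigma> assume "\<sigma> \<in> \<Delta> - {{}}"
    then have "card \<sigma> = Suc (card \<sigma> - 1)" using assms by (auto simp: card_gt_0_iff)
    then show "(- 1) ^ card \<sigma> = - ((- 1) ^ (card \<sigma> - 1) :: int)"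
      by (metis mult_minus1 power_Suc)
  qed
  then show ?thesis
    using assms by (simp add: sum.remove[of \<Delta> "{}"] euler_char_def sum_negf)
qed

text \<open>Removing \<open>\<rho>\<close> matches the cofaces of \<open>\<rho>\<close> with the
  faces of its link and lowers the cardinality by \<open>card \<rho>\<close>.\<close>

lemma sum_alternating_cofaces:
  assumes "abstract_complex \<Delta>" "\<rho> \<in> \<Delta>"
  shows "(\<Sum>\<sigma>\<in>{\<sigma>\<in>\<Delta>. \<rho> \<subseteq> \<sigma>}. (- 1) ^ card \<sigma>) =
    (- 1) ^ card \<rho> * (1 - euler_char (link \<Delta> \<rho>))"
proof -
  have fin: "finite \<sigma>" and down: "\<tau> \<subseteq> \<sigma> \<Longrightarrow> \<tau> \<in> \<Delta>" if "\<sigma> \<in> \<Delta>" for \<sigma> \<tau>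
    using assms that by (auto simp: abstract_complex_def)
  have "(\<Sum>\<sigma>\<in>{\<sigma>\<in>\<Delta>. \<rho> \<subseteq> \<sigma>}. (- 1 :: int) ^ card \<sigma>) =
    (\<Sum>\<tau>\<in>link \<Delta> \<rho>. (- 1) ^ card \<rho> * (- 1) ^ card \<tau>)"
  proof (rule sum.reindex_bij_witness[where i = "\<lambda>\<tau>. \<tau> \<union> \<rho>" and j = "\<lambda>\<sigma>. \<sigma> - \<rho>"])
    fix \<sigma> assume \<sigma>: "\<sigma> \<in> {\<sigma>\<in>\<Delta>. \<rho> \<subseteq> \<sigma>}"
    then have "card \<sigma> = card \<rho> + card (\<sigma> - \<rho>)"
      using fin by (metis (mono_tags, lifting) add_diff_inverse_nat card_Diff_subset card_mono
          finite_subset mem_Collect_eq not_less)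
    then show "(- 1 :: int) ^ card \<rho> * (- 1) ^ card (\<sigma> - \<rho>) = (- 1) ^ card \<sigma>"
      by (simp add: power_add)
    show "\<sigma> - \<rho> \<in> link \<Delta> \<rho>"
      using \<sigma> down[of \<sigma> "\<sigma> - \<rho>"] by (auto simp: link_def Un_absorb2)
  qed (auto simp: link_def)
  moreover have "(\<Sum>\<tau>\<in>link \<Delta> \<rho>. (- 1) ^ card \<tau>) = 1 - euler_char (link \<Delta> \<rho>)"
    using assms fin by (intro sum_alternating_faces) (auto simp: link_def abstract_complex_def)
  ultimately show ?thesis by (simp flip: sum_distrib_left)
qed

lemma one_minus_sphere_euler_char:
  "(- 1) ^ k * (1 - sphere_euler_char (int d - int k - 1)) = (- 1) ^ d"
  by (auto simp: sphere_euler_char_def minus_one_power_iff)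

lemma semi_eulerian_sum_cofaces:
  assumes "abstract_complex \<Delta>" "semi_eulerian d \<Delta>" "\<rho> \<in> \<Delta>"
  shows "(\<Sum>\<sigma>\<in>{\<sigma>\<in>\<Delta>. \<rho> \<subseteq> \<sigma>}. (- 1) ^ card \<sigma>) =
    (- 1) ^ d - (if \<rho> = {} then euler_char \<Delta> - sphere_euler_char (int d - 1) else 0)"
proof (cases "\<rho> = {}")
  case True
  \<comment> \<open>The semi-Eulerian condition says nothing about the empty face; its link is the
    whole complex, which is how \<open>euler_char \<Delta>\<close> enters.\<close>
  then have "link \<Delta> \<rho> = \<Delta>" by (auto simp: link_def)
  then show ?thesis
    using sum_alternating_cofaces[OF assms(1,3)] one_minus_sphere_euler_char[of 0 d] True by simp
next
  case False
  then show ?thesis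
    using sum_alternating_cofaces[OF assms(1,3)] assms one_minus_sphere_euler_char
    by (simp add: semi_eulerian_def)
qed

section \<open>Symmetry of the fine h-vector up to the Euler defect\<close>

theorem theorem3p8:
  fixes \<Delta> :: "'a set set" and \<phi> :: "'a \<Rightarrow> nat" and d m :: nat and a b :: "nat \<Rightarrow> nat"
  assumes "abstract_complex \<Delta>"
    and "connected_complex \<Delta>"
    and "pure_complex d \<Delta>"
    and "d \<ge> 4"
    and "semi_eulerian d \<Delta>"
    and "balanced_of_type d \<Delta> \<phi> m a"
    and "\<forall>j\<in>{1..m}. b j \<le> a j"
  shows "fine_h \<Delta> \<phi> m a (\<lambda>j. a j - b j) - fine_h \<Delta> \<phi> m a b =
    (- 1) ^ (\<Sum>j=1..m. b j) * (euler_char \<Delta> - sphere_euler_char (int d - 1)) *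
    (\<Prod>j=1..m. int (a j choose b j))"
proof -
  \<comment> \<open>\<open>E\<close> is the defect at the empty face; \<open>w\<close> and
    \<open>v\<close> are the face weights of h_(a-b) and h_b. In \<open>g\<close> the lower index
    \<open>a i - (a i - b i)\<close> is already reduced to \<open>b i\<close>.\<close>
  define E where "E = euler_char \<Delta> - sphere_euler_char (int d - 1)"
  define g where "g i k = (- 1 :: int) ^ (a i - b i + k) * int ((a i - k) choose b i)" for i k
  define w where "w \<rho> = (\<Prod>i=1..m. g i (colour_count \<phi> \<rho> i))" for \<rho>
  define v where "v \<rho> = (\<Prod>i=1..m. (- 1) ^ (b i + colour_count \<phi> \<rho> i) *
    int ((a i - colour_count \<phi> \<rho> i) choose (a i - b i)))" for \<rho>
  have fin: "finite \<Delta>" and empty: "{} \<in> \<Delta>" and fin_face: "\<And>\<sigma>. \<sigma> \<in> \<Delta> \<Longrightarrow> finite \<sigma>"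
    and down: "\<And>\<sigma> \<tau>. \<sigma> \<in> \<Delta> \<Longrightarrow> \<tau> \<subseteq> \<sigma> \<Longrightarrow> \<tau> \<in> \<Delta>"
    using assms(1) by (auto simp: abstract_complex_def)
  have b: "b j \<le> a j" if "j \<in> {1..m}" for j using assms(7) that by blast
  have sum_a: "(\<Sum>j=1..m. a j) = d"
    using assms(6) by (simp add: balanced_of_type_def)
  have colours: "\<phi> ` \<sigma> \<subseteq> {1..m}" if "\<sigma> \<in> \<Delta>" for \<sigma>
    using assms(6) that by (auto simp: balanced_of_type_def vertex_set_def)
  note le = colour_count_le_type[OF assms(1,6)]
  have h_b: "fine_h \<Delta> \<phi> m a b = sum v \<Delta>"
    unfolding v_def using fin le b by (rule fine_h_eq_sum_faces)
  have "fine_h \<Delta> \<phi> m a (\<lambda>j. a j - b j) = (\<Sum>\<rho>\<in>\<Delta>. \<Prod>i=1..m.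
    (- 1) ^ (a i - b i + colour_count \<phi> \<rho> i) *
    int ((a i - colour_count \<phi> \<rho> i) choose (a i - (a i - b i))))"
    using fin le by (rule fine_h_eq_sum_faces) auto
  also have "\<dots> = sum w \<Delta>"
    unfolding w_def g_def using b by (intro sum.cong prod.cong) auto
  finally have h_ab: "fine_h \<Delta> \<phi> m a (\<lambda>j. a j - b j) = sum w \<Delta>" .

  have sign: "(- 1 :: int) ^ d = (\<Prod>i=1..m. (- 1) ^ a i)"
    by (simp add: power_sum flip: sum_a)
  \<comment> \<open>Summing over subfaces exchanges the two weights. The sign of
    \<open>d + card \<sigma>\<close> splits into the signs of
    \<open>a i + colour_count \<phi> \<sigma> i\<close>, and the factor with exponent
    \<open>a i - b i\<close>, constant in the inner sum, turns each \<open>a i\<close> into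
    \<open>b i\<close>.\<close>
  have inner: "(- 1) ^ d * (- 1) ^ card \<sigma> * sum w (Pow \<sigma>) = v \<sigma>" if \<sigma>: "\<sigma> \<in> \<Delta>" for \<sigma>
  proof -
    have "sum w (Pow \<sigma>) = (\<Prod>i=1..m. \<Sum>\<tau>\<in>Pow (\<sigma> \<inter> \<phi> -` {i}). g i (card \<tau>))"
      unfolding w_def using fin_face[OF \<sigma>] colours[OF \<sigma>]
      by (intro sum_Pow_prod_colour_count) auto
    also have "\<dots> = (\<Prod>i=1..m. (- 1) ^ (a i - b i) *
      int ((a i - colour_count \<phi> \<sigma> i) choose (a i - b i)))"
    proof (rule prod.cong[OF refl])
      fix i assume i: "i \<in> {1..m}"
      have "(\<Sum>\<tau>\<in>Pow (\<sigma> \<inter> \<phi> -` {i}). (- 1) ^ card \<tau> * int ((a i - card \<tau>) choose b i)) =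
        int ((a i - colour_count \<phi> \<sigma> i) choose (a i - b i))"
        unfolding colour_count_def using fin_face[OF \<sigma>] le[OF \<sigma> i] b[OF i]
        by (intro alternating_sum_Pow_choose) (auto simp: colour_count_def)
      then show "(\<Sum>\<tau>\<in>Pow (\<sigma> \<inter> \<phi> -` {i}). g i (card \<tau>)) =
        (- 1) ^ (a i - b i) * int ((a i - colour_count \<phi> \<sigma> i) choose (a i - b i))"
        by (simp add: g_def power_add mult.assoc flip: sum_distrib_left)
    qed
    finally have w_sum: "sum w (Pow \<sigma>) = (\<Prod>i=1..m. (- 1) ^ (a i - b i) *
      int ((a i - colour_count \<phi> \<sigma> i) choose (a i - b i)))" .
    have "(- 1 :: int) ^ card \<sigma> = (\<Prod>i=1..m. (- 1) ^ colour_count \<phi> \<sigma> i)"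
      using card_eq_sum_colour_count[OF fin_face[OF \<sigma>] _ colours[OF \<sigma>]] by (simp add: power_sum)
    then have "(- 1) ^ d * (- 1) ^ card \<sigma> * sum w (Pow \<sigma>) =
      (\<Prod>i=1..m. (- 1) ^ a i * (- 1) ^ colour_count \<phi> \<sigma> i * ((- 1) ^ (a i - b i) *
        int ((a i - colour_count \<phi> \<sigma> i) choose (a i - b i))))"
      by (simp only: w_sum sign prod.distrib)
    also have "\<dots> = v \<sigma>"
      unfolding v_def
    proof (rule prod.cong[OF refl])
      fix i assume "i \<in> {1..m}"
      then have "(- 1 :: int) ^ a i * (- 1) ^ colour_count \<phi> \<sigma> i * (- 1) ^ (a i - b i) =
        (- 1) ^ (b i + colour_count \<phi> \<sigma> i)"
        using b[of i] by (auto simp: minus_one_power_iff)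
      then show "(- 1) ^ a i * (- 1) ^ colour_count \<phi> \<sigma> i * ((- 1) ^ (a i - b i) *
          int ((a i - colour_count \<phi> \<sigma> i) choose (a i - b i))) =
        (- 1) ^ (b i + colour_count \<phi> \<sigma> i) *
          int ((a i - colour_count \<phi> \<sigma> i) choose (a i - b i))"
        by (simp only: mult.assoc[symmetric])
    qed
    finally show ?thesis .
  qed

  \<comment> \<open>The coface identity multiplied by \<open>(- 1) ^ d\<close> expresses 1 as an
    alternating sum over cofaces, with a correction at the empty face only.\<close>
  have "w \<rho> = (- 1) ^ d * (w \<rho> * (\<Sum>\<sigma>\<in>{\<sigma>\<in>\<Delta>. \<rho> \<subseteq> \<sigma>}. (- 1) ^ card \<sigma>))
      + (if \<rho> = {} then (- 1) ^ d * E * w {} else 0)" if "\<rho> \<in> \<Delta>" for \<rho>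
    unfolding semi_eulerian_sum_cofaces[OF assms(1,5) that] E_def
    by (simp add: algebra_simps flip: power_add)
  then have "sum w \<Delta> = (\<Sum>\<rho>\<in>\<Delta>. (- 1) ^ d * (w \<rho> * (\<Sum>\<sigma>\<in>{\<sigma>\<in>\<Delta>. \<rho> \<subseteq> \<sigma>}. (- 1) ^ card \<sigma>))
      + (if \<rho> = {} then (- 1) ^ d * E * w {} else 0))"
    by (rule sum.cong[OF refl])
  also have "\<dots> = (\<Sum>\<rho>\<in>\<Delta>. \<Sum>\<sigma>\<in>{\<sigma>\<in>\<Delta>. \<rho> \<subseteq> \<sigma>}. (- 1) ^ d * (- 1) ^ card \<sigma> * w \<rho>)
      + (- 1) ^ d * E * w {}"
    using fin empty by (simp add: sum.distrib sum_distrib_left mult_ac)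
  \<comment> \<open>Both sides sum over the pairs of faces
    \<open>\<rho> \<subseteq> \<sigma>\<close>. With \<open>\<sigma>\<close> fixed, closure under
    subsets makes \<open>\<rho>\<close> range over \<open>Pow \<sigma>\<close>, so
    \<open>inner\<close> applies.\<close>
  also have "(\<Sum>\<rho>\<in>\<Delta>. \<Sum>\<sigma>\<in>{\<sigma>\<in>\<Delta>. \<rho> \<subseteq> \<sigma>}. (- 1) ^ d * (- 1) ^ card \<sigma> * w \<rho>) =
    (\<Sum>\<sigma>\<in>\<Delta>. \<Sum>\<rho>\<in>{\<rho>\<in>\<Delta>. \<rho> \<subseteq> \<sigma>}. (- 1) ^ d * (- 1) ^ card \<sigma> * w \<rho>)"
    using fin fin by (rule sum.swap_restrict)
  also have "\<dots> = sum v \<Delta>"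
  proof (rule sum.cong[OF refl])
    fix \<sigma> assume \<sigma>: "\<sigma> \<in> \<Delta>"
    then have "{\<rho>\<in>\<Delta>. \<rho> \<subseteq> \<sigma>} = Pow \<sigma>" using down by auto
    then show "(\<Sum>\<rho>\<in>{\<rho>\<in>\<Delta>. \<rho> \<subseteq> \<sigma>}. (- 1) ^ d * (- 1) ^ card \<sigma> * w \<rho>) = v \<sigma>"
      using inner[OF \<sigma>] by (simp add: sum_distrib_left)
  qed
  finally have "sum w \<Delta> - sum v \<Delta> = (- 1) ^ d * w {} * E" by simp
  \<comment> \<open>All colour counts of the empty face are 0; in each colour the signs with
    exponents \<open>a i\<close> and \<open>a i - b i\<close> combine to the sign of
    \<open>b i\<close>.\<close>
  moreover have "(- 1) ^ d * w {} = (- 1) ^ (\<Sum>j=1..m. b j) * (\<Prod>j=1..m. int (a j choose b j))"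
  proof -
    have "(- 1) ^ d * w {} = (\<Prod>i=1..m. (- 1) ^ a i * ((- 1) ^ (a i - b i) * int (a i choose b i)))"
      by (simp add: sign w_def g_def colour_count_def prod.distrib)
    also have "\<dots> = (\<Prod>i=1..m. (- 1) ^ b i * int (a i choose b i))"
      by (intro prod.cong) (auto simp: minus_one_power_iff dest!: b)
    finally show ?thesis by (simp add: prod.distrib power_sum)
  qed
  ultimately have "sum w \<Delta> - sum v \<Delta> =
    (- 1) ^ (\<Sum>j=1..m. b j) * (\<Prod>j=1..m. int (a j choose b j)) * E" by (simp only:)
  then show ?thesis
    unfolding h_b h_ab E_def by (simp only: mult_ac)
qed

end
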